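(* For every positive integer $n$ there is a bijection $\phi_n:\mathfrak{S}_{n-1}\times\{0,1,\dots,n-1\}\to\mathfrak{S}_n$ such that for all $\sigma\in\mathfrak{S}_{n-1}$ and $0\leq c\leq n-1$: $$\mathsf{Exc}(\phi_n(\sigma,c))=\begin{cases}\mathsf{Exc}(\sigma),& 0\leq c\leq\mathsf{exc}(\sigma),\\ \mathsf{Exc}(\sigma)\cup\{k_d\},&\text{otherwise,}\end{cases}\qquad \mathsf{den}(\phi_n(\sigma,c))=\mathsf{den}(\sigma)+c,$$ where $d=c-\mathsf{exc}(\sigma)$ and $k_d$ is the $d$-th smallest non-excedance of $\sigma$ (i.e., the $d$-th smallest element of $\{i\in[n-1]:\sigma_i\leq i\}$).
   Context: $\mathfrak{S}_m$ is the set of permutations of $[m]$ in one-line notation. A position $i$ is an excedance of $\sigma$ if $\sigma_i>i$, and a non-excedance otherwise; $\mathsf{Exc}(\sigma)$ is the set of excedances and $\mathsf{exc}(\sigma)=|\mathsf{Exc}(\sigma)|$. For a word $u$ of distinct integers, $\mathsf{inv}(u)$ counts pairs of positions $i<j$ with $u_i>u_j$. Denert's statistic: $\mathsf{den}(\sigma)=\sum_{i\in\mathsf{Exc}(\sigma)}i+\mathsf{inv}(\mathrm{EXCL}(\sigma))+\mathsf{inv}(\mathrm{NEXCL}(\sigma))$, where $\mathrm{EXCL}(\sigma)$ is the subsequence of letters $\sigma_i$ with $i\in\mathsf{Exc}(\sigma)$ and $\mathrm{NEXCL}(\sigma)$ the subsequence of the remaining letters. *)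

theory Defs
  imports "HOL-Combinatorics.Combinatorics"
begin

text \<open>
  A permutation of \<open>[m] = {1..m}\<close> is a function \<open>\<sigma> :: nat \<Rightarrow> nat\<close> with
  \<open>\<sigma> permutes {1..m}\<close>; its one-line notation is the word \<open>\<sigma> 1, \<dots>, \<sigma> m\<close>.
  Positions of permutations are numbered from 1. The size \<open>m\<close> is an explicit
  argument of every statistic.
\<close>

definition Exc :: "nat \<Rightarrow> (nat \<Rightarrow> nat) \<Rightarrow> nat set" where
  "Exc m \<sigma> = {i \<in> {1..m}. \<sigma> i > i}"

definition NExc :: "nat \<Rightarrow> (nat \<Rightarrow> nat) \<Rightarrow> nat set" where
  "NExc m \<sigma> = {i \<in> {1..m}. \<sigma> i \<le> i}"

definition exc :: "nat \<Rightarrow> (nat \<Rightarrow> nat) \<Rightarrow> nat" where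
  "exc m \<sigma> = card (Exc m \<sigma>)"

definition inv_word :: "nat list \<Rightarrow> nat" where
  "inv_word u = card {(i, j). i < j \<and> j < length u \<and> u ! i > u ! j}"

definition EXCL :: "nat \<Rightarrow> (nat \<Rightarrow> nat) \<Rightarrow> nat list" where
  "EXCL m \<sigma> = map \<sigma> (filter (\<lambda>i. i \<in> Exc m \<sigma>) [1..<Suc m])"

definition NEXCL :: "nat \<Rightarrow> (nat \<Rightarrow> nat) \<Rightarrow> nat list" where
  "NEXCL m \<sigma> = map \<sigma> (filter (\<lambda>i. i \<notin> Exc m \<sigma>) [1..<Suc m])"

definition den :: "nat \<Rightarrow> (nat \<Rightarrow> nat) \<Rightarrow> nat" where
  "den m \<sigma> = (\<Sum>i\<in>Exc m \<sigma>. i) + inv_word (EXCL m \<sigma>) + inv_word (NEXCL m \<sigma>)"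

text \<open>
  The \<open>d\<close>-th smallest non-excedance, counting from \<open>d = 1\<close> (lists are indexed from 0).
  It is meaningful for \<open>1 \<le> d \<le> m - exc m \<sigma>\<close>.
\<close>

definition nth_nexc :: "nat \<Rightarrow> (nat \<Rightarrow> nat) \<Rightarrow> nat \<Rightarrow> nat" where
  "nth_nexc m \<sigma> d = sorted_list_of_set (NExc m \<sigma>) ! (d - 1)"

end

theory Submission
  imports Defs "HOL-Computational_Algebra.Polynomial"
begin

text \<open>
  It suffices that the prescribed pair (excedance set, \<open>den\<close>) of \<open>(\<sigma>, c)\<close> and the actual pair of
  \<open>\<tau>\<close> have fibres of the same size. Fix the excedance set \<open>E\<close>. Choosing the letters of \<open>EXCL\<close>
  from right to left and those of \<open>NEXCL\<close> from left to right, one sees that the permutations with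
  excedance set \<open>E\<close>, weighted by their inversions, are counted by a product of two operators on
  sequences indexed by the number of open excedances: \<open>U\<close> (\<open>rise\<close>) at the positions in \<open>E\<close> and
  \<open>D\<close> (\<open>fall\<close>) at the others. These operators satisfy \<open>D U = q U D + U + D\<close>. The last position
  is never an excedance, so it contributes a factor \<open>D\<close>; moving this \<open>D\<close> through the word to the
  other end yields exactly the terms of the prescribed map: \<open>[k + 1]\<close> copies of the word with the
  last position removed, and for every \<open>e \<in> E\<close> a power of \<open>q\<close> times the word in which the
  \<open>U\<close> at \<open>e\<close> has been replaced by \<open>D\<close>.
\<close>

section \<open>Words with bounded letters\<close>

text \<open>The q-analogue \<open>1 + q + ... + q ^ (k - 1)\<close> of \<open>k\<close>. It lives in
  any commutative semiring so that \<open>q\<close> can later be the indeterminate of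
  \<open>nat poly\<close>.\<close>

definition qint :: "'a::comm_semiring_1 \<Rightarrow> nat \<Rightarrow> 'a" where
  "qint q k = (\<Sum>i<k. q ^ i)"

lemma qint_0 [simp]: "qint q 0 = 0"
  by (simp add: qint_def)

lemma qint_Suc: "qint q (Suc k) = 1 + q * qint q k"
  by (simp add: qint_def sum.lessThan_Suc_shift sum_distrib_left del: sum.lessThan_Suc)

lemma qint_Suc': "qint q (Suc k) = qint q k + q ^ k"
  by (simp add: qint_def)

text \<open>The ranks in \<open>A\<close> run through \<open>0, ..., card A - 1\<close>, each once.
  This weights the choice of one letter.\<close>

lemma sum_power_rank:
  fixes A :: "'b::linorder set"
  assumes "finite A"
  shows "(\<Sum>x\<in>A. q ^ card {y \<in> A. y < x}) = qint q (card A)"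
  using assms
proof (induction rule: finite_linorder_max_induct)
  case empty
  then show ?case by simp
next
  case (insert b A)
  have nb: "b \<notin> A" using insert.hyps by auto
  have "{y \<in> insert b A. y < x} = {y \<in> A. y < x}" if "x \<in> A" for x
    using that insert.hyps by auto
  moreover have "{y \<in> insert b A. y < b} = A"
    using insert.hyps by auto
  ultimately show ?case
    using insert nb by (simp add: qint_Suc' add.commute)
qed

section \<open>Inversions of words\<close>

lemma inv_word_Nil [simp]: "inv_word [] = 0"
  by (simp add: inv_word_def)

lemma inv_word_Cons: "inv_word (x # u) = length (filter (\<lambda>y. y < x) u) + inv_word u"
proof -
  let ?I = "\<lambda>u. {(i, j). i < j \<and> j < length u \<and> u ! i > (u ! j :: nat)}"
  let ?J = "{j. j < length u \<and> u ! j < x}"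
  have fin: "finite (?I u)"
    by (rule finite_subset[of _ "{..<length u} \<times> {..<length u}"]) auto
  have "?I (x # u) = (\<lambda>j. (0, Suc j)) ` ?J \<union> map_prod Suc Suc ` ?I u"
    (is "?L = ?R")
  proof (intro equalityI subsetI)
    fix p assume "p \<in> ?L"
    then obtain i j where p: "p = (i, j)" "i < j" "j < Suc (length u)" "(x # u) ! i > (x # u) ! j"
      by auto
    then obtain j' where j: "j = Suc j'" by (cases j) auto
    show "p \<in> ?R"
    proof (cases i)
      case 0
      then show ?thesis using p j by simp
    next
      case (Suc i')
      then have "(i', j') \<in> ?I u" using p j by simp
      then have "map_prod Suc Suc (i', j') \<in> ?R" by blast
      then show ?thesis using p j Suc by simp
    qed
  qed auto
  moreover have "card ((\<lambda>j. (0::nat, Suc j)) ` ?J \<union> map_prod Suc Suc ` ?I u) = card ?J + card (?I u)"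
    using fin by (subst card_Un_disjoint) (auto simp: card_image inj_on_def)
  ultimately show ?thesis
    by (simp add: inv_word_def length_filter_conv_card)
qed

lemma inv_word_snoc: "inv_word (u @ [x]) = length (filter (\<lambda>y. x < y) u) + inv_word u"
  by (induction u) (auto simp: inv_word_Cons)

text \<open>Complementing the letters and reversing the word both turn the order around, so
  inversions survive. The bound \<open>n\<close> keeps the truncated subtraction strictly
  order-reversing.\<close>

lemma inv_word_reflect:
  assumes "set u \<subseteq> {..n}"
  shows "inv_word (rev (map (\<lambda>v. n - v) u)) = inv_word u"
  using assms
proof (induction u)
  case (Cons x u)
  have "filter ((\<lambda>y. n - x < y) \<circ> (\<lambda>v. n - v)) u = filter (\<lambda>y. y < x) u"
    using Cons.prems by (intro filter_cong) auto
  moreover have "length (filter P (rev w)) = length (filter P w)" for P and w :: "nat list"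
    using length_rev[of "filter P w"] by (simp only: rev_filter)
  ultimately show ?case
    using Cons by (simp add: inv_word_Cons inv_word_snoc filter_map)
qed simp

lemma length_filter_distinct: "distinct u \<Longrightarrow> length (filter P u) = card {y \<in> set u. P y}"
  using distinct_card[of "filter P u"] by simp

text \<open>Strict upper bounds suffice: weak ones come from shifting by \<open>Suc\<close>, lower
  ones from reflection.\<close>

definition bounded_words :: "nat set \<Rightarrow> nat list \<Rightarrow> nat list set" where
  "bounded_words V bs = {u. distinct u \<and> set u = V \<and> list_all2 (<) u bs}"

lemma finite_distinct_words: "finite V \<Longrightarrow> finite {u. distinct u \<and> set u = V \<and> P u}"
  by (rule finite_subset[of _ "permutations_of_set V"]) (auto intro: permutations_of_setI)

lemma bounded_words_Cons:
  "bounded_words V (b # bs) = (\<Union>x\<in>{x \<in> V. x < b}. (#) x ` bounded_words (V - {x}) bs)"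
proof (intro equalityI subsetI)
  fix u assume "u \<in> bounded_words V (b # bs)"
  then have *: "distinct u" "set u = V" "list_all2 (<) u (b # bs)"
    by (simp_all add: bounded_words_def)
  then obtain x w where u: "u = x # w" "x < b" "list_all2 (<) w bs"
    unfolding list_all2_Cons2 by blast
  have "set w = V - {x}" "x \<in> V"
    using *(1,2) unfolding u(1) by auto
  then have "w \<in> bounded_words (V - {x}) bs"
    using *(1) u by (simp add: bounded_words_def)
  with \<open>x \<in> V\<close> u
  show "u \<in> (\<Union>x\<in>{x \<in> V. x < b}. (#) x ` bounded_words (V - {x}) bs)"
    by blast
next
  fix u assume "u \<in> (\<Union>x\<in>{x \<in> V. x < b}. (#) x ` bounded_words (V - {x}) bs)"
  then obtain x w where "x \<in> V" "x < b" "u = x # w" "w \<in> bounded_words (V - {x}) bs"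
    by blast
  moreover from this have "set (x # w) = V" "x \<notin> set w"
    by (auto simp: bounded_words_def)
  ultimately show "u \<in> bounded_words V (b # bs)"
    by (simp add: bounded_words_def)
qed

text \<open>Letters are chosen from left to right. As the bounds increase, all letters chosen
  earlier also lie below the current bound, so the number still available is independent of the
  choices made. The rank of the new letter among the available ones is the number of inversions that
  it begins.\<close>

lemma sum_bounded_words:
  assumes "sorted_wrt (<) bs" "finite V" "card V = length bs"
  shows "(\<Sum>u\<in>bounded_words V bs. (q :: 'a::comm_semiring_1) ^ inv_word u) =
    (\<Prod>b\<in>set bs. qint q (card {v \<in> V. v < b} - card {c \<in> set bs. c < b}))"
  using assms
proof (induction bs arbitrary: V)
  case Nil
  then have "bounded_words V [] = {[]}" by (auto simp: bounded_words_def)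
  then show ?case by simp
next
  case (Cons b bs)
  let ?X = "{x \<in> V. x < b}"
  let ?P = "\<Prod>c\<in>set bs. qint q (card {v \<in> V. v < c} - card {d \<in> set (b # bs). d < c})"
  have fin: "finite (bounded_words (V - {x}) bs)" for x
    unfolding bounded_words_def by (rule finite_distinct_words) (use Cons.prems in simp)
  have inner: "(\<Sum>u\<in>bounded_words (V - {x}) bs. q ^ inv_word (x # u)) =
      q ^ card {y \<in> ?X. y < x} * ?P" if x: "x \<in> ?X" for x
  proof -
    have "inv_word (x # u) = card {y \<in> ?X. y < x} + inv_word u"
      if "u \<in> bounded_words (V - {x}) bs" for u
    proof -
      have u: "distinct u" "set u = V - {x}"
        using that by (simp_all add: bounded_words_def)
      \<comment> \<open>Since \<open>x < b\<close>, every letter below \<open>x\<close> lies in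
        \<open>?X\<close>.\<close>
      have "{y \<in> set u. y < x} = {y \<in> ?X. y < x}"
        unfolding u(2) using x by auto
      then show ?thesis
        by (simp only: inv_word_Cons length_filter_distinct[OF u(1)])
    qed
    then have "(\<Sum>u\<in>bounded_words (V - {x}) bs. q ^ inv_word (x # u)) =
        q ^ card {y \<in> ?X. y < x} * (\<Sum>u\<in>bounded_words (V - {x}) bs. q ^ inv_word u)"
      unfolding sum_distrib_left power_add[symmetric] by (intro sum.cong refl) simp
    also have "(\<Sum>u\<in>bounded_words (V - {x}) bs. q ^ inv_word u) =
        (\<Prod>c\<in>set bs. qint q (card {v \<in> V - {x}. v < c} - card {d \<in> set bs. d < c}))"
      by (rule Cons.IH) (use Cons.prems x in auto)
    also have "\<dots> = ?P"
    proof (intro prod.cong refl)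
      fix c assume c: "c \<in> set bs"
      then have bc: "b < c" and nb: "b \<notin> set bs" using Cons.prems by auto
      \<comment> \<open>As \<open>x < b < c\<close>, removing \<open>x\<close> and \<open>b\<close>
        lowers both counts by one; the difference, even if truncated, is the same for every
        \<open>x\<close>.\<close>
      have "{v \<in> V. v < c} = insert x {v \<in> V - {x}. v < c}" using x bc by auto
      then have 1: "card {v \<in> V. v < c} = Suc (card {v \<in> V - {x}. v < c})"
        using Cons.prems by simp
      have "{d \<in> set (b # bs). d < c} = insert b {d \<in> set bs. d < c}" using bc by auto
      then have 2: "card {d \<in> set (b # bs). d < c} = Suc (card {d \<in> set bs. d < c})"
        using nb by simp
      show "qint q (card {v \<in> V - {x}. v < c} - card {d \<in> set bs. d < c}) =
          qint q (card {v \<in> V. v < c} - card {d \<in> set (b # bs). d < c})"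
        unfolding 1 2 by simp
    qed
    finally show ?thesis .
  qed
  have "(\<Sum>u\<in>bounded_words V (b # bs). q ^ inv_word u) =
      (\<Sum>x\<in>?X. \<Sum>u\<in>(#) x ` bounded_words (V - {x}) bs. q ^ inv_word u)"
    unfolding bounded_words_Cons
    by (rule sum.UNION_disjoint) (use Cons.prems fin in auto)
  also have "\<dots> = (\<Sum>x\<in>?X. \<Sum>u\<in>bounded_words (V - {x}) bs. q ^ inv_word (x # u))"
    by (simp add: sum.reindex)
  also have "\<dots> = (\<Sum>x\<in>?X. q ^ card {y \<in> ?X. y < x}) * ?P"
    unfolding sum_distrib_right by (intro sum.cong refl inner)
  also have "(\<Sum>x\<in>?X. q ^ card {y \<in> ?X. y < x}) = qint q (card ?X)"
    by (rule sum_power_rank) (use Cons.prems in simp)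
  \<comment> \<open>\<open>b\<close> is the least bound; subtracting an empty count gives its factor
    the shape of the others.\<close>
  also have "card ?X = card ?X - card {d \<in> set (b # bs). d < b}"
  proof -
    have "{d \<in> set (b # bs). d < b} = {}" using Cons.prems by auto
    then show ?thesis by (simp only: card.empty diff_zero)
  qed
  also have "qint q (card ?X - card {d \<in> set (b # bs). d < b}) * ?P =
     (\<Prod>c\<in>set (b # bs). qint q (card {v \<in> V. v < c} - card {d \<in> set (b # bs). d < c}))"
  proof -
    have "b \<notin> set bs" using Cons.prems by auto
    then have "prod F (set (b # bs)) = F b * prod F (set bs)" for F :: "nat \<Rightarrow> 'a"
      by simp
    from this[of "\<lambda>c. qint q (card {v \<in> V. v < c} - card {d \<in> set (b # bs). d < c})"]
    show ?thesis by (rule sym)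
  qed
  finally show ?case .
qed

text \<open>The weak bound \<open>r\<close> is the strict bound \<open>Suc r\<close>, and the shift
  keeps the number of earlier bounds.\<close>

lemma sum_nexc_words:
  assumes "sorted_wrt (<) rs" "finite V" "card V = length rs"
  shows "(\<Sum>u | distinct u \<and> set u = V \<and> list_all2 (\<le>) u rs. q ^ inv_word u) =
    (\<Prod>r\<in>set rs. qint q (card {v \<in> V. v \<le> r} - card {s \<in> set rs. s < r}))"
proof -
  have "{u. distinct u \<and> set u = V \<and> list_all2 (\<le>) u rs} = bounded_words V (map Suc rs)"
    by (simp add: bounded_words_def list_all2_map2 less_Suc_eq_le)
  moreover have "sorted_wrt (<) (map Suc rs)"
    using assms by (simp add: sorted_wrt_map)
  moreover have "card {s \<in> Suc ` set rs. s \<le> r} = card {s \<in> set rs. s < r}" for r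
  proof -
    have "{s \<in> Suc ` set rs. s \<le> r} = Suc ` {s \<in> set rs. s < r}" by auto
    then show ?thesis by (simp add: card_image)
  qed
  ultimately show ?thesis
    using assms by (simp add: sum_bounded_words prod.reindex less_Suc_eq_le)
qed

text \<open>The reflection \<open>v \<mapsto> n - v\<close> of positions and letters reduces this to words bounded from above.\<close>

lemma sum_exc_words:
  assumes "sorted_wrt (<) ps" "V \<subseteq> {..n}" "set ps \<subseteq> {..n}" "card V = length ps"
  shows "(\<Sum>u | distinct u \<and> set u = V \<and> list_all2 (>) u ps. q ^ inv_word u) =
    (\<Prod>p\<in>set ps. qint q (card {v \<in> V. p < v} - card {c \<in> set ps. p < c}))"
proof -
  let ?f = "\<lambda>v. n - v" and ?g = "\<lambda>u. rev (map (\<lambda>v. n - v) u)"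
  have inj: "inj_on ?f A" if "A \<subseteq> {..n}" for A
    by (rule inj_on_subset[OF _ that]) (auto simp: inj_on_def)
  have finV: "finite V" using assms(2) by (rule finite_subset) simp
  have inv: "map (?f \<circ> ?f) u = u" if "set u \<subseteq> {..n}" for u
    using that by (intro map_idI) auto
  have inv_img: "?f ` ?f ` V = V"
  proof -
    have "(\<lambda>v. n - (n - v)) ` V = (\<lambda>v. v) ` V"
      using assms(2) by (intro image_cong) auto
    then show ?thesis by (simp add: image_image)
  qed
  have cards: "card {c \<in> ?f ` A. c < n - p} = card {c \<in> A. p < c}"
    if "A \<subseteq> {..n}" "p \<le> n" for A p
  proof -
    have "{c \<in> ?f ` A. c < n - p} = ?f ` {c \<in> A. p < c}"
      using that by auto
    moreover have "card (?f ` {c \<in> A. p < c}) = card {c \<in> A. p < c}"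
      by (rule card_image, rule inj) (use that in auto)
    ultimately show ?thesis by simp
  qed
  have "(\<Sum>u | distinct u \<and> set u = V \<and> list_all2 (>) u ps. q ^ inv_word u) =
      (\<Sum>u\<in>bounded_words (?f ` V) (?g ps). q ^ inv_word u)"
  \<comment> \<open>On words with letters at most \<open>n\<close> the reflection is an involution,
    so it is its own inverse witness.\<close>
  proof (rule sum.reindex_bij_witness[where i = ?g and j = ?g])
    fix u assume "u \<in> {u. distinct u \<and> set u = V \<and> list_all2 (>) u ps}"
    then have u: "distinct u" "set u = V" "list_all2 (>) u ps" by auto
    then have un: "set u \<subseteq> {..n}" using assms by simp
    show "?g (?g u) = u" using inv[OF un] by (simp add: rev_map[symmetric] comp_def)
    have "list_all2 (\<lambda>x p. n - x < n - p) u ps"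
      using u(3) by (rule list.rel_mono_strong) (use un in auto)
    then show "?g u \<in> bounded_words (?f ` V) (?g ps)"
      using u inj[OF un] by (auto simp: bounded_words_def distinct_map list_all2_map1 list_all2_map2)
    show "q ^ inv_word (?g u) = q ^ inv_word u"
      using inv_word_reflect[OF un] by simp
  next
    fix u assume "u \<in> bounded_words (?f ` V) (?g ps)"
    then have u: "distinct u" "set u = ?f ` V" "list_all2 (<) u (?g ps)"
      by (auto simp: bounded_words_def)
    then have un: "set u \<subseteq> {..n}" by auto
    show "?g (?g u) = u" using inv[OF un] by (simp add: rev_map[symmetric] comp_def)
    have "list_all2 (<) (rev u) (map ?f ps)" using u(3) list_all2_rev[of "(<)" "rev u"] by simp
    then have "list_all2 (\<lambda>x p. x < n - p) (rev u) ps" by (simp add: list_all2_map2)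
    then have "list_all2 (\<lambda>x p. n - x > p) (rev u) ps"
      by (rule list.rel_mono_strong) (use un in auto)
    then show "?g u \<in> {u. distinct u \<and> set u = V \<and> list_all2 (>) u ps}"
      using u inj[OF un] inv_img by (auto simp: distinct_map list_all2_map1 rev_map)
  qed
  also have "\<dots> = (\<Prod>b\<in>?f ` set ps. qint q (card {v \<in> ?f ` V. v < b} - card {c \<in> ?f ` set ps. c < b}))"
  proof -
    have "sorted_wrt (<) (?g ps)"
      unfolding sorted_wrt_rev sorted_wrt_map
      by (rule sorted_wrt_mono_rel[OF _ assms(1)]) (use assms(3) in auto)
    then show ?thesis
      using sum_bounded_words[of "?g ps" "?f ` V" q] finV assms inj by (simp add: card_image)
  qed
  also have "\<dots> = (\<Prod>p\<in>set ps. qint q (card {v \<in> V. p < v} - card {c \<in> set ps. p < c}))"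
  proof (subst prod.reindex[OF inj[OF assms(3)]], intro prod.cong refl)
    fix p assume "p \<in> set ps"
    then have "p \<le> n" using assms(3) by auto
    then show "((\<lambda>b. qint q (card {v \<in> ?f ` V. v < b} - card {c \<in> ?f ` set ps. c < b})) \<circ> ?f) p =
        qint q (card {v \<in> V. p < v} - card {c \<in> set ps. p < c})"
      using cards[OF assms(2)] cards[OF assms(3)] by simp
  qed
  finally show ?thesis .
qed

section \<open>Path operators\<close>

text \<open>The operator \<open>U\<close>. The index \<open>h\<close> counts the open excedances
  after the step: excedance positions up to the current one whose letters lie beyond it. The
  summands \<open>x (h - 1)\<close> and \<open>x h\<close> belong to the cases that the current
  number is not, or is, an excedance letter. At \<open>h = 0\<close> the factor
  \<open>qint q 0 = 0\<close> removes the truncated index.\<close>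

definition rise :: "'a::comm_semiring_1 \<Rightarrow> (nat \<Rightarrow> 'a) \<Rightarrow> nat \<Rightarrow> 'a" where
  "rise q x h = qint q h * (x (h - 1) + x h)"

text \<open>The operator \<open>D\<close>. The number of open excedances stays at \<open>h\<close>,
  or drops from \<open>Suc h\<close> when the current number is an excedance letter.\<close>

definition fall :: "'a::comm_semiring_1 \<Rightarrow> (nat \<Rightarrow> 'a) \<Rightarrow> nat \<Rightarrow> 'a" where
  "fall q x h = qint q (Suc h) * (x h + x (Suc h))"

text \<open>Both double applications combine \<open>x (h - 1) + x h\<close> and
  \<open>x h + x (Suc h)\<close> with the same second factors; their first factors are
  \<open>qint q (Suc h)\<close> and \<open>qint q h\<close>, and
  \<open>qint q (Suc h) = 1 + q * qint q h\<close> leaves one \<open>U\<close> and one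
  \<open>D\<close>.\<close>

lemma fall_rise: "fall q (rise q x) h = q * rise q (fall q x) h + rise q x h + fall q x h"
  by (cases h) (simp_all add: rise_def fall_def qint_Suc algebra_simps)

lemma rise_lincomb:
  "rise q (\<lambda>h. a * x h + (\<Sum>e\<in>A. b e * y e h)) h = a * rise q x h + (\<Sum>e\<in>A. b e * rise q (y e) h)"
  by (simp add: rise_def algebra_simps sum_distrib_left sum.distrib)

lemma fall_lincomb:
  "fall q (\<lambda>h. a * x h + (\<Sum>e\<in>A. b e * y e h)) h = a * fall q x h + (\<Sum>e\<in>A. b e * fall q (y e) h)"
  by (simp add: fall_def algebra_simps sum_distrib_left sum.distrib)

text \<open>The start vector says that no excedance is open; the position read last gives the
  outermost operator.\<close>

primrec path_vec :: "'a::comm_semiring_1 \<Rightarrow> nat set \<Rightarrow> nat \<Rightarrow> nat \<Rightarrow> 'a" where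
  "path_vec q E 0 = (\<lambda>h. if h = 0 then 1 else 0)"
| "path_vec q E (Suc j) = (if Suc j \<in> E then rise q (path_vec q E j) else fall q (path_vec q E j))"

lemma path_vec_cong: "(\<And>i. i \<in> {1..m} \<Longrightarrow> i \<in> E \<longleftrightarrow> i \<in> E') \<Longrightarrow> path_vec q E m = path_vec q E' m"
  by (induction m) auto

text \<open>The outer \<open>D\<close> moves inwards to the start vector, which it fixes. It
  commutes with each \<open>D\<close>; at each \<open>U\<close> the term \<open>q U D\<close> moves
  on, the term \<open>U\<close> restores the word, and the term \<open>D\<close> replaces this
  \<open>U\<close>. The powers of \<open>q\<close> count the \<open>U\<close> already passed, and
  those of the restored word add up to the q-integer.\<close>

lemma fall_path_vec:
  fixes q :: "'a::comm_semiring_1"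
  shows "fall q (path_vec q E m) h = qint q (Suc (card (E \<inter> {1..m}))) * path_vec q E m h +
    (\<Sum>e\<in>E \<inter> {1..m}. q ^ card (E \<inter> {e<..m}) * path_vec q (E - {e}) m h)"
proof (induction m arbitrary: h)
  case 0
  then show ?case by (simp add: fall_def qint_Suc)
next
  case (Suc m)
  let ?k = "card (E \<inter> {1..m})" and ?W = "path_vec q E m"
  have IH: "fall q ?W = (\<lambda>h. qint q (Suc ?k) * ?W h +
      (\<Sum>e\<in>E \<inter> {1..m}. q ^ card (E \<inter> {e<..m}) * path_vec q (E - {e}) m h))"
    using Suc.IH by blast
  show ?case
  proof (cases "Suc m \<in> E")
    case True
    have ins: "E \<inter> {1..Suc m} = insert (Suc m) (E \<inter> {1..m})"
      using True by auto
    \<comment> \<open>The \<open>D\<close> term at \<open>Suc m\<close> will be the new summand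
      \<open>e = Suc m\<close>, with exponent 0.\<close>
    have last: "path_vec q (E - {Suc m}) m = ?W"
      by (rule path_vec_cong) auto
    have step: "q ^ card (E \<inter> {e<..Suc m}) * path_vec q (E - {e}) (Suc m) h =
        q * (q ^ card (E \<inter> {e<..m}) * rise q (path_vec q (E - {e}) m) h)"
      if "e \<in> E \<inter> {1..m}" for e
    proof -
      have "E \<inter> {e<..Suc m} = insert (Suc m) (E \<inter> {e<..m})"
        using that True by auto
      then have "card (E \<inter> {e<..Suc m}) = Suc (card (E \<inter> {e<..m}))" by simp
      then show ?thesis using that True by (simp add: mult.assoc)
    qed
    let ?R = "\<Sum>e\<in>E \<inter> {1..m}. q ^ card (E \<inter> {e<..m}) * rise q (path_vec q (E - {e}) m) h"
    have "fall q (path_vec q E (Suc m)) h = q * rise q (fall q ?W) h + rise q ?W h + fall q ?W h"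
      using True by (simp add: fall_rise)
    also have "rise q (fall q ?W) h = qint q (Suc ?k) * rise q ?W h + ?R"
      unfolding IH by (rule rise_lincomb)
    \<comment> \<open>The \<open>U\<close> term supplies the 1 in
      \<open>1 + q * qint q (Suc ?k)\<close>.\<close>
    finally have 1: "fall q (path_vec q E (Suc m)) h =
        qint q (Suc (Suc ?k)) * rise q ?W h + (fall q ?W h + q * ?R)"
      unfolding qint_Suc[of q "Suc ?k"] by (simp only: algebra_simps mult_1_left mult_1_right)
    have "(\<Sum>e\<in>E \<inter> {1..m}. q ^ card (E \<inter> {e<..Suc m}) * path_vec q (E - {e}) (Suc m) h) = q * ?R"
      unfolding sum_distrib_left by (intro sum.cong refl step)
    moreover have "q ^ card (E \<inter> {Suc m<..Suc m}) * path_vec q (E - {Suc m}) (Suc m) h = fall q ?W h"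
      using last by simp
    moreover have "card (E \<inter> {1..Suc m}) = Suc ?k"
      unfolding ins by simp
    moreover have "path_vec q E (Suc m) h = rise q ?W h"
      using True by simp
    moreover have "sum F (insert (Suc m) (E \<inter> {1..m})) = F (Suc m) + sum F (E \<inter> {1..m})"
      for F :: "nat \<Rightarrow> 'a" by simp
    ultimately show ?thesis
      unfolding 1 ins by simp
  next
    case False
    have ins: "E \<inter> {1..Suc m} = E \<inter> {1..m}"
      using False by (auto simp: le_Suc_eq)
    have "E \<inter> {e<..Suc m} = E \<inter> {e<..m}" for e
      using False by (auto simp: le_Suc_eq)
    \<comment> \<open>Only the inner \<open>fall\<close> is expanded; the outer one is the step at
      \<open>Suc m\<close> and acts on each term.\<close>
    moreover have "fall q (fall q ?W) h = qint q (Suc ?k) * fall q ?W h +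
        (\<Sum>e\<in>E \<inter> {1..m}. q ^ card (E \<inter> {e<..m}) * fall q (path_vec q (E - {e}) m) h)"
      by (subst (1) IH) (rule fall_lincomb)
    ultimately show ?thesis
      unfolding ins using False by simp
  qed
qed

text \<open>
  \<open>V\<close> stands for the set of excedance letters. Sets that admit no filling need not be excluded:
  they make the subtraction truncate, and then the weight is \<open>qint q 0 = 0\<close>.
\<close>

definition step_weight :: "'a::comm_semiring_1 \<Rightarrow> nat set \<Rightarrow> nat set \<Rightarrow> nat \<Rightarrow> 'a" where
  "step_weight q E V i =
    qint q ((if i \<in> E then 0 else 1) + card (E \<inter> {1..i}) - card (V \<inter> {1..i}))"

text \<open>In the expansion each step picks one of two summands, which decides whether
  \<open>i\<close> belongs to \<open>V\<close>. The index after step \<open>i\<close> is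
  \<open>card (E \<inter> {1..i}) - card (V \<inter> {1..i})\<close>, and it determines the
  weight.\<close>

lemma path_vec_eq_sum:
  "path_vec q E j h =
    (\<Sum>V | V \<subseteq> {1..j} \<and> card V + h = card (E \<inter> {1..j}). \<Prod>i\<in>{1..j}. step_weight q E V i)"
proof (induction j arbitrary: h)
  case 0
  have "{V. V \<subseteq> {1..0::nat} \<and> card V + h = card (E \<inter> {1..0})} = (if h = 0 then {{}} else {})" by auto
  then show ?case by (simp only:) simp
next
  case (Suc j)
  define c where "c = card (E \<inter> {1..Suc j})"
  define S where "S c h = {V. V \<subseteq> {1..j} \<and> card V + h = c}" for c h :: nat
  \<comment> \<open>With this offset \<open>qint q (t + h)\<close> is the factor of
    \<open>rise\<close> as well as of \<open>fall\<close>.\<close>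
  define t where "t = (if Suc j \<in> E then 0 else 1 :: nat)"
  let ?w = "\<lambda>V. \<Prod>i\<in>{1..j}. step_weight q E V i"
  have fin: "finite (S c h)" for c h
    by (rule finite_subset[of _ "Pow {1..j}"]) (auto simp: S_def)
  have fV: "finite V" if "V \<subseteq> {1..j}" for V
    using that by (rule finite_subset) simp
  have card_ins: "card (insert (Suc j) V) = Suc (card V)" if "V \<subseteq> {1..j}" for V
    using that fV by (subst card_insert_disjoint) auto
  have split: "{V. V \<subseteq> {1..Suc j} \<and> card V + h = c} = S c h \<union> insert (Suc j) ` S c (Suc h)"
    (is "?L = _")
  proof (intro equalityI subsetI)
    fix V assume V: "V \<in> ?L"
    show "V \<in> S c h \<union> insert (Suc j) ` S c (Suc h)"
    proof (cases "Suc j \<in> V")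
      case True
      have sub: "V - {Suc j} \<subseteq> {1..j}" using V by (auto simp: le_Suc_eq)
      have eq: "V = insert (Suc j) (V - {Suc j})" using True by auto
      then have "card V = Suc (card (V - {Suc j}))" using card_ins[OF sub] by simp
      then have "V - {Suc j} \<in> S c (Suc h)" using V sub by (simp add: S_def)
      then show ?thesis using eq by blast
    next
      case False
      then have "V \<subseteq> {1..j}" using V by (auto simp: le_Suc_eq)
      then show ?thesis using V by (simp add: S_def)
    qed
  next
    fix V assume "V \<in> S c h \<union> insert (Suc j) ` S c (Suc h)"
    then consider "V \<in> S c h" | V' where "V = insert (Suc j) V'" "V' \<in> S c (Suc h)"
      by blast
    then show "V \<in> ?L"
    proof cases
      case 1
      then have "V \<subseteq> {1..j}" "card V + h = c" by (simp_all add: S_def)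
      moreover have "{1..j} \<subseteq> {1..Suc j}" by simp
      ultimately show ?thesis by blast
    next
      case 2
      then have "V' \<subseteq> {1..j}" "card V' + Suc h = c" by (simp_all add: S_def)
      moreover have "{1..j} \<subseteq> {1..Suc j}" by simp
      ultimately show ?thesis unfolding 2(1) using card_ins[of V'] by auto
    qed
  qed
  have w1: "(\<Prod>i\<in>{1..Suc j}. step_weight q E V i) = qint q (t + h) * ?w V" if "V \<in> S c h" for V
  proof -
    have "V \<inter> {1..Suc j} = V" using that by (auto simp: S_def)
    moreover have "card (E \<inter> {1..Suc j}) = card V + h" using that by (simp add: S_def c_def)
    ultimately have "step_weight q E V (Suc j) = qint q (t + h)"
      by (simp add: step_weight_def t_def)
    then show ?thesis by (simp add: mult.commute)
  qed
  have w2: "(\<Prod>i\<in>{1..Suc j}. step_weight q E (insert (Suc j) V) i) = qint q (t + h) * ?w V"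
    if "V \<in> S c (Suc h)" for V
  proof -
    have sub: "V \<subseteq> {1..j}" using that by (simp add: S_def)
    then have "insert (Suc j) V \<inter> {1..Suc j} = insert (Suc j) V" by auto
    moreover have "card (E \<inter> {1..Suc j}) = card (insert (Suc j) V) + h"
      using that card_ins[OF sub] by (simp add: S_def c_def)
    ultimately have "step_weight q E (insert (Suc j) V) (Suc j) = qint q (t + h)"
      by (simp add: step_weight_def t_def)
    moreover have "step_weight q E (insert (Suc j) V) i = step_weight q E V i" if "i \<in> {1..j}" for i
    proof -
      have "insert (Suc j) V \<inter> {1..i} = V \<inter> {1..i}" using that by auto
      then show ?thesis by (simp add: step_weight_def)
    qed
    ultimately show ?thesis by (simp add: mult.commute)
  qed
  have inj: "inj_on (insert (Suc j)) (S c (Suc h))"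
  proof (rule inj_onI)
    fix V V' assume V: "V \<in> S c (Suc h)" "V' \<in> S c (Suc h)" and eq: "insert (Suc j) V = insert (Suc j) V'"
    then have "Suc j \<notin> V" "Suc j \<notin> V'" by (auto simp: S_def)
    then show "V = V'" using eq by (metis insert_ident)
  qed
  have "S c h \<inter> insert (Suc j) ` S c (Suc h) = {}" by (auto simp: S_def)
  then have "(\<Sum>V | V \<subseteq> {1..Suc j} \<and> card V + h = c. \<Prod>i\<in>{1..Suc j}. step_weight q E V i) =
      (\<Sum>V\<in>S c h. \<Prod>i\<in>{1..Suc j}. step_weight q E V i) +
      (\<Sum>V\<in>S c (Suc h). \<Prod>i\<in>{1..Suc j}. step_weight q E (insert (Suc j) V) i)"
    unfolding split using fin inj by (simp add: sum.union_disjoint sum.reindex)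
  also have "\<dots> = qint q (t + h) * ((\<Sum>V\<in>S c h. ?w V) + (\<Sum>V\<in>S c (Suc h). ?w V))"
    unfolding distrib_left sum_distrib_left
    by (rule arg_cong2[of _ _ _ _ "(+)"], rule sum.cong[OF refl w1], assumption,
        rule sum.cong[OF refl w2], assumption)
  also have "\<dots> = path_vec q E (Suc j) h"
  proof (cases "Suc j \<in> E")
    case True
    have "E \<inter> {1..Suc j} = insert (Suc j) (E \<inter> {1..j})" using True by auto
    then have c: "c = Suc (card (E \<inter> {1..j}))" by (simp add: c_def)
    \<comment> \<open>The new excedance raises \<open>c\<close> by one, so
      \<open>S c (Suc h)\<close> carries the old index \<open>h\<close> and \<open>S c h\<close> the
      old index \<open>h - 1\<close>; for \<open>h = 0\<close> the common factor vanishes.\<close>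
    have 1: "(\<Sum>V\<in>S c (Suc h). ?w V) = path_vec q E j h" for h
      unfolding Suc.IH S_def c by simp
    show ?thesis
    proof (cases h)
      case 0
      then show ?thesis using True by (simp add: t_def rise_def)
    next
      case (Suc h')
      then show ?thesis using True 1[of h] 1[of h'] by (simp add: t_def rise_def)
    qed
  next
    case False
    then have "E \<inter> {1..Suc j} = E \<inter> {1..j}" by (auto simp: le_Suc_eq)
    then have c: "c = card (E \<inter> {1..j})" by (simp add: c_def)
    have "(\<Sum>V\<in>S c h. ?w V) = path_vec q E j h" for h
      unfolding Suc.IH S_def c by simp
    then show ?thesis using False by (simp add: t_def fall_def)
  qed
  finally show ?case unfolding c_def by simp
qed

section \<open>Permutations with a given excedance set\<close>

text \<open>Recovers a permutation from its letters listed in any order of the positions; below, the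
  excedances come first.\<close>

lemma permutes_map_eq_exists:
  assumes "distinct L" "distinct l" "set l = set L"
  shows "\<exists>\<tau>. \<tau> permutes set L \<and> map \<tau> L = l"
proof -
  have len: "length l = length L" using assms by (metis distinct_card)
  \<comment> \<open>Distinctness of \<open>L\<close> makes the index unique, and
    \<open>permutes\<close> asks for the identity outside \<open>set L\<close>.\<close>
  define \<tau> where "\<tau> x = (if x \<in> set L then l ! (THE i. i < length L \<and> L ! i = x) else x)" for x
  have idx: "(THE i. i < length L \<and> L ! i = L ! j) = j" if "j < length L" for j
    using that assms(1) by (auto simp: nth_eq_iff_index_eq)
  have nth: "\<tau> (L ! j) = l ! j" if "j < length L" for j
    using that by (simp add: \<tau>_def idx)
  have map: "map \<tau> L = l"
    by (rule nth_equalityI) (simp_all add: len nth)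
  then have "inj_on \<tau> (set L)" "\<tau> ` set L = set L"
    using assms by (metis distinct_map, metis list.set_map)
  then have "bij_betw \<tau> (set L) (set L)"
    by (simp add: bij_betw_def)
  then have "\<tau> permutes set L"
    by (rule bij_imp_permutes) (simp add: \<tau>_def)
  with map show ?thesis by blast
qed

text \<open>Once the set \<open>V\<close> of excedance letters is fixed, \<open>EXCL\<close> and
  \<open>NEXCL\<close> are chosen independently, each with a product formula. Together the factors
  are the step weights of one path, which ends with no open excedance.\<close>

lemma sum_inv_word_fixed_Exc:
  assumes "E \<subseteq> {1..n}"
  shows "(\<Sum>\<tau> | \<tau> permutes {1..n} \<and> Exc n \<tau> = E. q ^ (inv_word (EXCL n \<tau>) + inv_word (NEXCL n \<tau>))) =
    path_vec q E n 0"
proof -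
  define ps where "ps = filter (\<lambda>i. i \<in> E) [1..<Suc n]"
  define rs where "rs = filter (\<lambda>i. i \<notin> E) [1..<Suc n]"
  define A where "A V = {u. distinct u \<and> set u = V \<and> list_all2 (>) u ps}" for V
  define B where "B V = {w. distinct w \<and> set w = {1..n} - V \<and> list_all2 (\<le>) w rs}" for V
  define P where "P = {\<tau>. \<tau> permutes {1..n} \<and> Exc n \<tau> = E}"
  \<comment> \<open>The summand 0 is the final index \<open>h = 0\<close> in
    \<open>path_vec_eq_sum\<close>.\<close>
  define W where "W = {V. V \<subseteq> {1..n} \<and> card V + 0 = card (E \<inter> {1..n})}"
  have ps: "set ps = E" "sorted_wrt (<) ps" "distinct ps"
  proof -
    show "set ps = E"
      using assms unfolding ps_def set_filter set_upt by (auto simp: less_Suc_eq_le)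
    show "sorted_wrt (<) ps" "distinct ps"
      unfolding ps_def by (simp_all only: sorted_wrt_filter sorted_wrt_upt distinct_filter distinct_upt)
  qed
  have rs: "set rs = {1..n} - E" "sorted_wrt (<) rs" "distinct rs"
  proof -
    show "set rs = {1..n} - E"
      unfolding rs_def set_filter set_upt by (auto simp: less_Suc_eq_le)
    show "sorted_wrt (<) rs" "distinct rs"
      unfolding rs_def by (simp_all only: sorted_wrt_filter sorted_wrt_upt distinct_filter distinct_upt)
  qed
  have finE: "finite E" using assms by (rule finite_subset) simp
  have lps: "length ps = card E"
    using distinct_card[OF ps(3)] unfolding ps(1) by (rule sym)
  have lrs: "length rs = card ({1..n} - E)"
    using distinct_card[OF rs(3)] unfolding rs(1) by (rule sym)
  have EE: "E \<inter> {1..n} = E" using assms by auto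
  have set_L: "set (ps @ rs) = {1..n}"
    unfolding set_append ps(1) rs(1) using assms by blast
  have dist_L: "distinct (ps @ rs)"
    unfolding distinct_append ps(1) rs(1) using ps(3) rs(3) by blast
  have finA: "finite (A V)" if "V \<in> W" for V
  proof -
    have "V \<subseteq> {1..n}" using that by (simp add: W_def)
    then have "finite V" by (rule finite_subset) simp
    then show ?thesis unfolding A_def by (rule finite_distinct_words)
  qed
  have finB: "finite (B V)" for V
    unfolding B_def by (rule finite_distinct_words) simp
  have finW: "finite W"
    by (rule finite_subset[of _ "Pow {1..n}"]) (auto simp: W_def)
  have words: "EXCL n \<tau> = map \<tau> ps" "NEXCL n \<tau> = map \<tau> rs" if "\<tau> \<in> P" for \<tau>
    using that by (simp_all add: EXCL_def NEXCL_def ps_def rs_def P_def)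
  have Exc_iff: "Exc n \<tau> = E \<longleftrightarrow> (\<forall>p\<in>E. p < \<tau> p) \<and> (\<forall>r\<in>{1..n} - E. \<tau> r \<le> r)" for \<tau>
  proof
    assume "(\<forall>p\<in>E. p < \<tau> p) \<and> (\<forall>r\<in>{1..n} - E. \<tau> r \<le> r)"
    then have E: "\<forall>p\<in>E. p < \<tau> p" and N: "\<forall>r\<in>{1..n} - E. \<tau> r \<le> r"
      by simp_all
    show "Exc n \<tau> = E"
    proof (intro equalityI subsetI)
      fix i assume "i \<in> Exc n \<tau>"
      then have "i \<in> {1..n}" "\<not> \<tau> i \<le> i" by (simp_all add: Exc_def)
      then show "i \<in> E" using N by blast
    next
      fix i assume "i \<in> E"
      then show "i \<in> Exc n \<tau>" using E assms unfolding Exc_def by blast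
    qed
  next
    assume E: "Exc n \<tau> = E"
    show "(\<forall>p\<in>E. p < \<tau> p) \<and> (\<forall>r\<in>{1..n} - E. \<tau> r \<le> r)"
      unfolding E[symmetric] by (simp add: Exc_def not_less)
  qed
  have bij: "bij_betw (\<lambda>\<tau>. (\<tau> ` E, map \<tau> ps, map \<tau> rs)) P (SIGMA V:W. A V \<times> B V)"
  proof (rule bij_betw_imageI)
    show "inj_on (\<lambda>\<tau>. (\<tau> ` E, map \<tau> ps, map \<tau> rs)) P"
    proof (rule inj_onI)
      fix \<tau> \<tau>' assume t: "\<tau> \<in> P" "\<tau>' \<in> P"
        and eq: "(\<tau> ` E, map \<tau> ps, map \<tau> rs) = (\<tau>' ` E, map \<tau>' ps, map \<tau>' rs)"
      show "\<tau> = \<tau>'"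
      proof
        fix x
        show "\<tau> x = \<tau>' x"
        proof (cases "x \<in> {1..n}")
          case True
          then have "x \<in> set ps \<or> x \<in> set rs" unfolding set_L[symmetric] by simp
          moreover have "map \<tau> ps = map \<tau>' ps" "map \<tau> rs = map \<tau>' rs" using eq by simp_all
          ultimately show ?thesis unfolding map_eq_conv by blast
        next
          case False
          have "\<tau> permutes {1..n}" "\<tau>' permutes {1..n}" using t by (simp_all add: P_def)
          then show ?thesis by (simp only: permutes_not_in[OF _ False])
        qed
      qed
    qed
  next
    show "(\<lambda>\<tau>. (\<tau> ` E, map \<tau> ps, map \<tau> rs)) ` P = (SIGMA V:W. A V \<times> B V)"
    proof (intro equalityI subsetI)
      fix z assume "z \<in> (\<lambda>\<tau>. (\<tau> ` E, map \<tau> ps, map \<tau> rs)) ` P"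
      then obtain \<tau> where z: "z = (\<tau> ` E, map \<tau> ps, map \<tau> rs)"
        and perm: "\<tau> permutes {1..n}" and E: "Exc n \<tau> = E"
        unfolding P_def by blast
      have inj: "inj_on \<tau> X" for X using perm by (rule permutes_inj_on)
      have img: "\<tau> ` {1..n} = {1..n}" using perm by (rule permutes_image)
      have "\<tau> ` E \<in> W"
        using image_mono[OF assms, of \<tau>] unfolding img W_def EE by (simp add: card_image[OF inj])
      moreover have "map \<tau> ps \<in> A (\<tau> ` E)"
        using E ps(3) inj unfolding Exc_iff A_def
        by (simp add: distinct_map list_all2_map1 list_all2_same ps(1))
      moreover have "\<tau> ` ({1..n} - E) = {1..n} - \<tau> ` E"
        using inj_on_image_set_diff[OF inj[of "{1..n}"] Diff_subset assms] unfolding img .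
      then have "map \<tau> rs \<in> B (\<tau> ` E)"
        using E rs(3) inj unfolding Exc_iff B_def
        by (simp add: distinct_map list_all2_map1 list_all2_same rs(1))
      ultimately show "z \<in> (SIGMA V:W. A V \<times> B V)" unfolding z by simp
    next
      fix z assume "z \<in> (SIGMA V:W. A V \<times> B V)"
      then obtain V u w where z: "z = (V, u, w)" and V: "V \<in> W" and u: "u \<in> A V" and w: "w \<in> B V"
        by blast
      have lu: "length u = length ps" using u unfolding A_def by (blast dest: list_all2_lengthD)
      have su: "distinct u" "set u = V" and sw: "distinct w" "set w = {1..n} - V" and "V \<subseteq> {1..n}"
        using u w V by (simp_all add: A_def B_def W_def)
      then have "distinct (u @ w)" "set (u @ w) = {1..n}"
        by (simp_all add: Un_absorb1)
      then obtain \<tau> where perm: "\<tau> permutes {1..n}" and map: "map \<tau> (ps @ rs) = u @ w"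
        using permutes_map_eq_exists[OF dist_L, unfolded set_L] by blast
      then have maps: "map \<tau> ps = u" "map \<tau> rs = w" using lu by simp_all
      have "list_all2 (>) (map \<tau> ps) ps" "list_all2 (\<le>) (map \<tau> rs) rs"
        using u w unfolding maps A_def B_def by simp_all
      then have "\<forall>p\<in>E. p < \<tau> p" "\<forall>r\<in>{1..n} - E. \<tau> r \<le> r"
        unfolding list_all2_map1 list_all2_same ps(1) rs(1) by simp_all
      then have "Exc n \<tau> = E" unfolding Exc_iff by (rule conjI)
      then have "\<tau> \<in> P" using perm by (simp add: P_def)
      moreover have "\<tau> ` E = V"
        using u unfolding A_def maps(1)[symmetric] by (simp add: ps(1))
      then have "z = (\<tau> ` E, map \<tau> ps, map \<tau> rs)" by (simp only: z maps)
      ultimately show "z \<in> (\<lambda>\<tau>. (\<tau> ` E, map \<tau> ps, map \<tau> rs)) ` P"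
        by blast
    qed
  qed
  have "(\<Sum>\<tau>\<in>P. q ^ (inv_word (EXCL n \<tau>) + inv_word (NEXCL n \<tau>))) =
      (\<Sum>\<tau>\<in>P. (\<lambda>(V, u, w). q ^ inv_word u * q ^ inv_word w) (\<tau> ` E, map \<tau> ps, map \<tau> rs))"
    by (intro sum.cong refl) (simp add: words power_add)
  also have "\<dots> = (\<Sum>(V, u, w)\<in>(SIGMA V:W. A V \<times> B V). q ^ inv_word u * q ^ inv_word w)"
    by (rule sum.reindex_bij_betw[OF bij])
  also have "\<dots> = (\<Sum>V\<in>W. \<Sum>(u, w)\<in>A V \<times> B V. q ^ inv_word u * q ^ inv_word w)"
    using finW finA finB by (subst sum.Sigma) (auto simp: case_prod_unfold)
  also have "\<dots> = (\<Sum>V\<in>W. (\<Sum>u\<in>A V. q ^ inv_word u) * (\<Sum>w\<in>B V. q ^ inv_word w))"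
    by (simp add: sum_product sum.cartesian_product)
  also have "\<dots> = (\<Sum>V\<in>W. \<Prod>i\<in>{1..n}. step_weight q E V i)"
  proof (intro sum.cong refl)
    fix V assume "V \<in> W"
    then have V: "V \<subseteq> {1..n}" and cardV: "card V = card E"
      by (simp_all add: W_def EE[unfolded One_nat_def])
    have finV: "finite V" using V by (rule finite_subset) simp
    \<comment> \<open>Rewrites the counts above a position by counts up to it; the totals then
      cancel because \<open>card V = card E\<close>.\<close>
    have above: "card {v \<in> X. i < v} = card X - card (X \<inter> {1..i})" if "X \<subseteq> {1..n}" for X i
    proof -
      have "{v \<in> X. i < v} = X - X \<inter> {1..i}" using that by auto
      moreover have "finite X" using that by (rule finite_subset) simp
      ultimately show ?thesis by (simp add: card_Diff_subset)
    qed
    have "(\<Sum>u\<in>A V. q ^ inv_word u) =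
        (\<Prod>p\<in>E. qint q (card {v \<in> V. p < v} - card {c \<in> E. p < c}))"
      unfolding A_def
      by (subst sum_exc_words[where n = n]) (use ps V assms cardV lps in auto)
    also have "\<dots> = (\<Prod>p\<in>E. step_weight q E V p)"
    proof (intro prod.cong refl)
      fix p assume "p \<in> E"
      moreover have "card (E \<inter> {1..p}) \<le> card E" "card (V \<inter> {1..p}) \<le> card V"
        using finE finV by (simp_all add: card_mono)
      ultimately show "qint q (card {v \<in> V. p < v} - card {c \<in> E. p < c}) = step_weight q E V p"
        by (simp add: above[OF V] above[OF assms] step_weight_def cardV)
    qed
    finally have 1: "(\<Sum>u\<in>A V. q ^ inv_word u) = (\<Prod>p\<in>E. step_weight q E V p)" .
    have "(\<Sum>w\<in>B V. q ^ inv_word w) =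
        (\<Prod>r\<in>{1..n} - E. qint q (card {v \<in> {1..n} - V. v \<le> r} - card {s \<in> {1..n} - E. s < r}))"
      unfolding B_def
      by (subst sum_nexc_words) (use rs V assms cardV lrs finE finV in \<open>auto simp: card_Diff_subset\<close>)
    also have "\<dots> = (\<Prod>r\<in>{1..n} - E. step_weight q E V r)"
    proof (intro prod.cong refl)
      fix r assume r: "r \<in> {1..n} - E"
      have "{v \<in> {1..n} - V. v \<le> r} = {1..r} - V \<inter> {1..r}" using r by auto
      then have a: "card {v \<in> {1..n} - V. v \<le> r} = r - card (V \<inter> {1..r})"
        by (simp add: card_Diff_subset)
      \<comment> \<open>As \<open>r\<close> is not in \<open>E\<close>, the truncated subtractions
        below are exact; the earlier non-excedances number one less than
        \<open>r - card (E \<inter> {1..r})\<close>, whence the 1 in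
        \<open>step_weight\<close>.\<close>
      have sub: "E \<inter> {1..r} \<subseteq> {1..r - 1}"
      proof
        fix x assume "x \<in> E \<inter> {1..r}"
        moreover from this have "x \<noteq> r" using r by auto
        ultimately show "x \<in> {1..r - 1}" by auto
      qed
      have "{s \<in> {1..n} - E. s < r} = {1..r - 1} - E \<inter> {1..r}" using r by auto
      then have b: "card {s \<in> {1..n} - E. s < r} = r - 1 - card (E \<inter> {1..r})"
        using sub by (simp add: card_Diff_subset)
      have "card (E \<inter> {1..r}) \<le> r - 1" "card (V \<inter> {1..r}) \<le> r"
        using card_mono[OF _ sub] card_mono[of "{1..r}" "V \<inter> {1..r}"] by auto
      then show "qint q (card {v \<in> {1..n} - V. v \<le> r} - card {s \<in> {1..n} - E. s < r}) =
          step_weight q E V r"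
        unfolding a b step_weight_def using r by (intro arg_cong[of _ _ "qint q"]) auto
    qed
    finally have 2: "(\<Sum>w\<in>B V. q ^ inv_word w) = (\<Prod>r\<in>{1..n} - E. step_weight q E V r)" .
    show "(\<Sum>u\<in>A V. q ^ inv_word u) * (\<Sum>w\<in>B V. q ^ inv_word w) = (\<Prod>i\<in>{1..n}. step_weight q E V i)"
      unfolding 1 2 using prod.subset_diff[OF assms, of "step_weight q E V"] by (simp add: mult.commute)
  qed
  also have "\<dots> = path_vec q E n 0"
    unfolding path_vec_eq_sum W_def ..
  finally show ?thesis by (simp add: P_def)
qed

section \<open>Comparison of the fibres\<close>

text \<open>Arbitrary bijections between corresponding fibres are glued together, so the resulting
  map is not explicit.\<close>

lemma bij_betw_of_equal_fibres:
  assumes "finite X" "finite Y"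
    and "\<And>k. card {x \<in> X. f x = k} = card {y \<in> Y. g y = k}"
  shows "\<exists>\<phi>. bij_betw \<phi> X Y \<and> (\<forall>x\<in>X. g (\<phi> x) = f x)"
proof -
  have "\<exists>h. bij_betw h {x \<in> X. f x = k} {y \<in> Y. g y = k}" for k
    by (rule finite_same_card_bij) (simp_all add: assms)
  then obtain h where h: "\<And>k. bij_betw (h k) {x \<in> X. f x = k} {y \<in> Y. g y = k}"
    by metis
  define \<phi> where "\<phi> x = h (f x) x" for x
  have \<phi>: "\<phi> x \<in> Y" "g (\<phi> x) = f x" if "x \<in> X" for x
    using bij_betwE[OF h[of "f x"]] that by (auto simp: \<phi>_def)
  have "bij_betw \<phi> X Y"
  proof (rule bij_betw_imageI)
    show "inj_on \<phi> X"
    proof (rule inj_onI)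
      fix x x' assume x: "x \<in> X" "x' \<in> X" and eq: "\<phi> x = \<phi> x'"
      then have k: "f x = f x'" using \<phi>(2) by metis
      show "x = x'"
        using inj_onD[OF bij_betw_imp_inj_on[OF h[of "f x"]], of x x'] x eq k
        by (simp add: \<phi>_def)
    qed
    show "\<phi> ` X = Y"
    proof (intro equalityI subsetI)
      fix y assume "y \<in> Y"
      then have "y \<in> h (g y) ` {x \<in> X. f x = g y}"
        using bij_betw_imp_surj_on[OF h[of "g y"]] by simp
      then obtain x where x: "x \<in> X" "f x = g y" "y = h (g y) x" by blast
      then have "y = \<phi> x" by (simp add: \<phi>_def)
      then show "y \<in> \<phi> ` X" using x(1) by (rule image_eqI)
    qed (use \<phi>(1) in blast)
  qed
  then show ?thesis using \<phi>(2) by blast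
qed

text \<open>With \<open>q\<close> as the indeterminate, an identity of weighted sums becomes an
  equality of fibre sizes.\<close>

lemma coeff_sum_power_eq_card:
  assumes "finite X"
  shows "coeff (\<Sum>x\<in>X. (monom 1 1 :: nat poly) ^ f x) k = card {x \<in> X. f x = k}"
proof -
  have "coeff (\<Sum>x\<in>X. (monom 1 1 :: nat poly) ^ f x) k = (\<Sum>x\<in>X. if f x = k then 1 else 0)"
    by (simp add: coeff_sum monom_power cong: if_cong)
  also have "\<dots> = card {x \<in> X. f x = k}"
    using assms by (simp add: sum.If_cases Int_def)
  finally show ?thesis .
qed

text \<open>The entry at index \<open>i\<close>, counted from 0, has exactly \<open>i\<close>
  smaller elements, so a list index can be traded for a rank.\<close>

lemma sum_sorted_list_of_set:
  fixes S :: "'b::linorder set"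
  assumes "finite S"
  shows "(\<Sum>i<card S. F (sorted_list_of_set S ! i) i) = (\<Sum>e\<in>S. F e (card {s \<in> S. s < e}))"
proof -
  let ?l = "sorted_list_of_set S"
  have bij: "bij_betw ((!) ?l) {..<card S} S"
    by (rule bij_betw_nth) (simp_all add: assms)
  have "card {s \<in> S. s < ?l ! i} = i" if "i < card S" for i
  proof -
    have less: "?l ! j < ?l ! i \<longleftrightarrow> j < i" if "j < card S" for j
    proof
      assume "?l ! j < ?l ! i"
      then show "j < i"
        using sorted_nth_mono[of ?l i j] that by (force simp: not_less)
    next
      assume "j < i"
      then show "?l ! j < ?l ! i"
        using \<open>i < card S\<close> by (intro sorted_wrt_nth_less[of "(<)"]) simp_all
    qed
    have "{s \<in> S. s < ?l ! i} = (!) ?l ` {..<i}"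
    proof (intro equalityI subsetI)
      fix s assume s: "s \<in> {s \<in> S. s < ?l ! i}"
      then have "s \<in> (!) ?l ` {..<card S}" using bij_betw_imp_surj_on[OF bij] by blast
      then obtain j where "j < card S" "s = ?l ! j" by blast
      then show "s \<in> (!) ?l ` {..<i}" using s less by blast
    next
      fix s assume "s \<in> (!) ?l ` {..<i}"
      then obtain j where j: "j < i" "s = ?l ! j" by blast
      then have "j < card S" using that by simp
      then show "s \<in> {s \<in> S. s < ?l ! i}"
        using j less bij_betwE[OF bij] by blast
    qed
    moreover have "inj_on ((!) ?l) {..<i}"
      by (rule inj_on_subset[OF bij_betw_imp_inj_on[OF bij]]) (use that in auto)
    ultimately show ?thesis by (simp add: card_image)
  qed
  then have "(\<Sum>i<card S. F (?l ! i) i) = (\<Sum>i<card S. F (?l ! i) (card {s \<in> S. s < ?l ! i}))"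
    by simp
  also have "\<dots> = (\<Sum>e\<in>S. F e (card {s \<in> S. s < e}))"
    by (rule sum.reindex_bij_betw[OF bij])
  finally show ?thesis .
qed

section \<open>Fibres of the prescribed excedance set and \<open>den\<close>\<close>

lemma NExc_eq: "NExc m \<sigma> = {1..m} - Exc m \<sigma>"
  by (auto simp: NExc_def Exc_def)

lemma Exc_subset: "Exc m \<sigma> \<subseteq> {1..m}"
  by (auto simp: Exc_def)

lemma card_NExc: "card (NExc m \<sigma>) = m - exc m \<sigma>" and exc_le: "exc m \<sigma> \<le> m"
  using card_mono[OF _ Exc_subset, of m \<sigma>]
    card_Diff_subset[OF finite_subset[OF Exc_subset] Exc_subset, of m \<sigma>]
  by (simp_all add: NExc_eq exc_def)

definition extended_Exc :: "nat \<Rightarrow> (nat \<Rightarrow> nat) \<Rightarrow> nat \<Rightarrow> nat set" where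
  "extended_Exc m \<sigma> c =
    (if c \<le> exc m \<sigma> then Exc m \<sigma> else Exc m \<sigma> \<union> {nth_nexc m \<sigma> (c - exc m \<sigma>)})"

lemma sum_lessThan_add: "sum g {..<a + b :: nat} = sum g {..<a} + (\<Sum>i<b. g (a + i))"
  by (induction b) (simp_all add: add.assoc)

text \<open>For \<open>c\<close> beyond \<open>exc m \<sigma>\<close>, the number \<open>c\<close>
  and the added non-excedance \<open>e\<close> determine each other:
  \<open>c - exc m \<sigma>\<close> is one more than the number of non-excedances below
  \<open>e\<close>.\<close>

lemma sum_extended_Exc:
  "(\<Sum>c\<le>m. F (extended_Exc m \<sigma> c) c) = (\<Sum>c\<le>exc m \<sigma>. F (Exc m \<sigma>) c) +
    (\<Sum>e\<in>NExc m \<sigma>. F (insert e (Exc m \<sigma>)) (exc m \<sigma> + Suc (card {s \<in> NExc m \<sigma>. s < e})))"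
proof -
  let ?k = "exc m \<sigma>"
  have m: "m = ?k + card (NExc m \<sigma>)" using card_NExc exc_le by simp
  have fin: "finite (NExc m \<sigma>)" by (simp add: NExc_def)
  have "(\<Sum>c\<le>m. F (extended_Exc m \<sigma> c) c) =
      (\<Sum>c<Suc ?k + card (NExc m \<sigma>). F (extended_Exc m \<sigma> c) c)"
    by (subst m) (simp add: lessThan_Suc_atMost[symmetric])
  also have "\<dots> = (\<Sum>c<Suc ?k. F (extended_Exc m \<sigma> c) c) +
      (\<Sum>i<card (NExc m \<sigma>). F (extended_Exc m \<sigma> (Suc ?k + i)) (Suc ?k + i))"
    by (rule sum_lessThan_add)
  also have "(\<Sum>c<Suc ?k. F (extended_Exc m \<sigma> c) c) = (\<Sum>c\<le>?k. F (Exc m \<sigma>) c)"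
    unfolding lessThan_Suc_atMost by (intro sum.cong refl) (simp add: extended_Exc_def)
  \<comment> \<open>Here \<open>d = Suc i\<close>; \<open>nth_nexc\<close> subtracts 1 again, so the
    list index is \<open>i\<close>.\<close>
  also have "(\<Sum>i<card (NExc m \<sigma>). F (extended_Exc m \<sigma> (Suc ?k + i)) (Suc ?k + i)) =
      (\<Sum>i<card (NExc m \<sigma>).
        F (insert (sorted_list_of_set (NExc m \<sigma>) ! i) (Exc m \<sigma>)) (?k + Suc i))"
    by (intro sum.cong refl) (simp add: extended_Exc_def nth_nexc_def)
  also have "\<dots> = (\<Sum>e\<in>NExc m \<sigma>. F (insert e (Exc m \<sigma>)) (?k + Suc (card {s \<in> NExc m \<sigma>. s < e})))"
    by (rule sum_sorted_list_of_set[OF fin])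
  finally show ?thesis .
qed

lemma extended_Exc_subset:
  assumes "c \<le> m"
  shows "extended_Exc m \<sigma> c \<subseteq> {1..m}"
proof (cases "c \<le> exc m \<sigma>")
  case True
  then show ?thesis using Exc_subset by (simp add: extended_Exc_def)
next
  case False
  have "sorted_list_of_set (NExc m \<sigma>) ! (c - exc m \<sigma> - 1) \<in> set (sorted_list_of_set (NExc m \<sigma>))"
    by (rule nth_mem) (use False assms card_NExc[of m \<sigma>] in simp)
  also have "\<dots> = NExc m \<sigma>" by (simp add: NExc_def)
  also have "NExc m \<sigma> \<subseteq> {1..m}" by (auto simp: NExc_def)
  finally show ?thesis
    using False Exc_subset[of m \<sigma>] by (simp add: extended_Exc_def nth_nexc_def)
qed

lemma sum_den_fixed_Exc:
  assumes "E \<subseteq> {1..n}"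
  shows "(\<Sum>\<tau> | \<tau> permutes {1..n} \<and> Exc n \<tau> = E. q ^ den n \<tau>) = q ^ (\<Sum>E) * path_vec q E n 0"
proof -
  have "(\<Sum>\<tau> | \<tau> permutes {1..n} \<and> Exc n \<tau> = E. q ^ den n \<tau>) =
      (\<Sum>\<tau> | \<tau> permutes {1..n} \<and> Exc n \<tau> = E.
        q ^ (\<Sum>E) * q ^ (inv_word (EXCL n \<tau>) + inv_word (NEXCL n \<tau>)))"
    by (intro sum.cong refl) (simp add: den_def power_add mult.assoc)
  then show ?thesis
    using sum_inv_word_fixed_Exc[OF assms, of q] by (simp only: sum_distrib_left[symmetric])
qed

text \<open>Either \<open>\<sigma>\<close> already has excedance set \<open>E\<close> and
  \<open>c\<close> runs up to \<open>card E\<close>, or some \<open>e\<close> in \<open>E\<close> is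
  new and \<open>c\<close> is forced. These are the terms of \<open>fall_path_vec\<close>, once the
  excedance sums are put into the exponents.\<close>

lemma sum_den_extended_Exc:
  fixes q :: "'a::comm_semiring_1"
  assumes E: "E \<subseteq> {1..m}"
  shows "(\<Sum>(\<sigma>, c) | \<sigma> permutes {1..m} \<and> c \<le> m \<and> extended_Exc m \<sigma> c = E. q ^ (den m \<sigma> + c)) =
    q ^ (\<Sum>E) * path_vec q E (Suc m) 0"
proof -
  define P where "P = {\<sigma>. \<sigma> permutes {1..m}}"
  let ?k = "card E"
  have finP: "finite P" unfolding P_def by (rule finite_permutations) simp
  have finE: "finite E" using E by (rule finite_subset) simp
  have EE: "E \<inter> {1..m} = E" using E by auto
  have restrict: "(\<Sum>\<sigma>\<in>P. if Exc m \<sigma> = A then q ^ den m \<sigma> else 0) = q ^ (\<Sum>A) * path_vec q A m 0"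
    if "A \<subseteq> {1..m}" for A
    unfolding sum_den_fixed_Exc[OF that, symmetric] sum.inter_filter[OF finP, symmetric]
    by (simp add: P_def)
  \<comment> \<open>The left-hand side is \<open>c\<close> plus the excedance sum of \<open>\<sigma>\<close> when \<open>e\<close> is the new excedance.\<close>
  have rank: "card (E - {e}) + Suc (card {s \<in> {1..m} - (E - {e}). s < e}) + \<Sum>(E - {e}) =
      \<Sum>E + card (E \<inter> {e<..m})" if e: "e \<in> E" for e
  proof -
    have em: "e \<in> {1..m}" using e E by blast
    have "{s \<in> {1..m} - (E - {e}). s < e} = {1..e - 1} - {c \<in> E. c < e}"
      using em by auto
    moreover have sub: "{c \<in> E. c < e} \<subseteq> {1..e - 1}" using E by auto
    ultimately have "card {s \<in> {1..m} - (E - {e}). s < e} = e - 1 - card {c \<in> E. c < e}"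
      using finE by (simp add: card_Diff_subset)
    moreover have "card {c \<in> E. c < e} \<le> e - 1" using card_mono[OF _ sub] by simp
    moreover have "e \<ge> 1" using em by simp
    moreover have "\<Sum>E = e + \<Sum>(E - {e})" using finE e by (simp add: sum.remove)
    moreover have "card (E - {e}) = card {c \<in> E. c < e} + card (E \<inter> {e<..m})"
    proof -
      have "E - {e} = {c \<in> E. c < e} \<union> (E \<inter> {e<..m})" using E by auto
      moreover have "{c \<in> E. c < e} \<inter> (E \<inter> {e<..m}) = {}" by auto
      ultimately show ?thesis using finE by (simp add: card_Un_disjoint)
    qed
    \<comment> \<open>The number of elements of \<open>E\<close> below \<open>e\<close> cancels;
      what remains is \<open>e\<close> plus the number above it.\<close>
    ultimately show ?thesis by linarith
  qed
  \<comment> \<open>The range of \<open>e\<close> becomes independent of \<open>\<sigma>\<close>, so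
    that the two sums can be interchanged.\<close>
  have swap: "(\<Sum>e\<in>NExc m \<sigma>. if insert e (Exc m \<sigma>) = E then G e else 0) =
      (\<Sum>e\<in>E. if Exc m \<sigma> = E - {e} then G e else 0)" for \<sigma> and G :: "nat \<Rightarrow> 'a"
  proof -
    have "(\<Sum>e\<in>NExc m \<sigma>. if insert e (Exc m \<sigma>) = E then G e else 0) =
        sum G {e \<in> NExc m \<sigma>. insert e (Exc m \<sigma>) = E}"
      by (rule sum.inter_filter[symmetric]) (simp add: NExc_def)
    also have "{e \<in> NExc m \<sigma>. insert e (Exc m \<sigma>) = E} = {e \<in> E. Exc m \<sigma> = E - {e}}"
      using E by (auto simp: NExc_eq)
    also have "sum G \<dots> = (\<Sum>e\<in>E. if Exc m \<sigma> = E - {e} then G e else 0)"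
      by (rule sum.inter_filter[OF finE])
    finally show ?thesis .
  qed
  have per_perm: "(\<Sum>c\<le>m. if extended_Exc m \<sigma> c = E then q ^ (den m \<sigma> + c) else 0) =
      qint q (Suc ?k) * (if Exc m \<sigma> = E then q ^ den m \<sigma> else 0) +
      (\<Sum>e\<in>E. q ^ (card (E - {e}) + Suc (card {s \<in> {1..m} - (E - {e}). s < e})) *
        (if Exc m \<sigma> = E - {e} then q ^ den m \<sigma> else 0))" for \<sigma>
  proof -
    have "(\<Sum>c\<le>m. if extended_Exc m \<sigma> c = E then q ^ (den m \<sigma> + c) else 0) =
        (\<Sum>c\<le>exc m \<sigma>. if Exc m \<sigma> = E then q ^ (den m \<sigma> + c) else 0) +
        (\<Sum>e\<in>NExc m \<sigma>. if insert e (Exc m \<sigma>) = E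
          then q ^ (den m \<sigma> + (exc m \<sigma> + Suc (card {s \<in> NExc m \<sigma>. s < e}))) else 0)"
      by (rule sum_extended_Exc[where F = "\<lambda>A c. if A = E then q ^ (den m \<sigma> + c) else 0"])
    also have "(\<Sum>c\<le>exc m \<sigma>. if Exc m \<sigma> = E then q ^ (den m \<sigma> + c) else 0) =
        qint q (Suc ?k) * (if Exc m \<sigma> = E then q ^ den m \<sigma> else 0)"
      by (simp add: exc_def qint_def lessThan_Suc_atMost power_add sum_distrib_left mult.commute
          del: sum.lessThan_Suc)
    also have "(\<Sum>e\<in>NExc m \<sigma>. if insert e (Exc m \<sigma>) = E
          then q ^ (den m \<sigma> + (exc m \<sigma> + Suc (card {s \<in> NExc m \<sigma>. s < e}))) else 0) =
        (\<Sum>e\<in>E. q ^ (card (E - {e}) + Suc (card {s \<in> {1..m} - (E - {e}). s < e})) *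
          (if Exc m \<sigma> = E - {e} then q ^ den m \<sigma> else 0))"
      unfolding swap
      by (intro sum.cong refl) (simp add: NExc_eq exc_def power_add mult_ac)
    finally show ?thesis .
  qed
  have "{(\<sigma>, c). \<sigma> permutes {1..m} \<and> c \<le> m \<and> extended_Exc m \<sigma> c = E} =
      {z \<in> P \<times> {..m}. extended_Exc m (fst z) (snd z) = E}"
    by (auto simp: P_def)
  then have "(\<Sum>(\<sigma>, c) | \<sigma> permutes {1..m} \<and> c \<le> m \<and> extended_Exc m \<sigma> c = E. q ^ (den m \<sigma> + c)) =
      (\<Sum>z\<in>P \<times> {..m}. if extended_Exc m (fst z) (snd z) = E then q ^ (den m (fst z) + snd z) else 0)"
    using finP by (simp add: sum.inter_filter case_prod_unfold)
  also have "\<dots> = (\<Sum>\<sigma>\<in>P. \<Sum>c\<le>m. if extended_Exc m \<sigma> c = E then q ^ (den m \<sigma> + c) else 0)"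
    by (simp add: sum.cartesian_product case_prod_unfold)
  also have "\<dots> = qint q (Suc ?k) * (\<Sum>\<sigma>\<in>P. if Exc m \<sigma> = E then q ^ den m \<sigma> else 0) +
      (\<Sum>e\<in>E. q ^ (card (E - {e}) + Suc (card {s \<in> {1..m} - (E - {e}). s < e})) *
        (\<Sum>\<sigma>\<in>P. if Exc m \<sigma> = E - {e} then q ^ den m \<sigma> else 0))"
    unfolding per_perm sum.distrib sum_distrib_left[symmetric]
    by (subst sum.swap) (simp only: sum_distrib_left[symmetric])
  also have "(\<Sum>e\<in>E. q ^ (card (E - {e}) + Suc (card {s \<in> {1..m} - (E - {e}). s < e})) *
        (\<Sum>\<sigma>\<in>P. if Exc m \<sigma> = E - {e} then q ^ den m \<sigma> else 0)) =
      (\<Sum>e\<in>E. q ^ (\<Sum>E) * (q ^ card (E \<inter> {e<..m}) * path_vec q (E - {e}) m 0))"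
  proof (intro sum.cong refl)
    fix e assume e: "e \<in> E"
    have "E - {e} \<subseteq> {1..m}" using E by blast
    then show "q ^ (card (E - {e}) + Suc (card {s \<in> {1..m} - (E - {e}). s < e})) *
        (\<Sum>\<sigma>\<in>P. if Exc m \<sigma> = E - {e} then q ^ den m \<sigma> else 0) =
        q ^ (\<Sum>E) * (q ^ card (E \<inter> {e<..m}) * path_vec q (E - {e}) m 0)"
      by (simp only: restrict mult.assoc[symmetric] power_add[symmetric] rank[OF e])
  qed
  also have "qint q (Suc ?k) * (\<Sum>\<sigma>\<in>P. if Exc m \<sigma> = E then q ^ den m \<sigma> else 0) =
      q ^ (\<Sum>E) * (qint q (Suc ?k) * path_vec q E m 0)"
    unfolding restrict[OF E] by (rule mult.left_commute)
  also have "q ^ (\<Sum>E) * (qint q (Suc ?k) * path_vec q E m 0) +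
      (\<Sum>e\<in>E. q ^ (\<Sum>E) * (q ^ card (E \<inter> {e<..m}) * path_vec q (E - {e}) m 0)) =
      q ^ (\<Sum>E) * fall q (path_vec q E m) 0"
    unfolding fall_path_vec EE by (simp only: distrib_left sum_distrib_left)
  \<comment> \<open>\<open>Suc m\<close> lies outside \<open>E\<close>, so the last step is a
    \<open>fall\<close>.\<close>
  also have "fall q (path_vec q E m) 0 = path_vec q E (Suc m) 0"
    using E by auto
  finally show ?thesis .
qed

theorem theorem2p1:
  fixes n :: nat
  assumes "n \<ge> 1"
  shows "\<exists>\<phi> :: (nat \<Rightarrow> nat) \<times> nat \<Rightarrow> (nat \<Rightarrow> nat).
    bij_betw \<phi> ({\<sigma>. \<sigma> permutes {1..n - 1}} \<times> {0..n - 1}) {\<tau>. \<tau> permutes {1..n}} \<and>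
    (\<forall>\<sigma> c. \<sigma> permutes {1..n - 1} \<and> c \<le> n - 1 \<longrightarrow>
       Exc n (\<phi> (\<sigma>, c)) =
         (if c \<le> exc (n - 1) \<sigma> then Exc (n - 1) \<sigma>
          else Exc (n - 1) \<sigma> \<union> {nth_nexc (n - 1) \<sigma> (c - exc (n - 1) \<sigma>)}) \<and>
       den n (\<phi> (\<sigma>, c)) = den (n - 1) \<sigma> + c)"
proof -
  obtain m where n: "n = Suc m" using assms by (cases n) simp_all
  define X where "X = {\<sigma>. \<sigma> permutes {1..m}} \<times> {0..m}"
  define Y where "Y = {\<tau>. \<tau> permutes {1..Suc m}}"
  \<comment> \<open>\<open>f\<close> is the prescribed pair and \<open>g\<close> the actual one;
    equal fibres give the bijection.\<close>
  define f where "f = (\<lambda>(\<sigma>, c). (extended_Exc m \<sigma> c, den m \<sigma> + c))"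
  define g where "g \<tau> = (Exc (Suc m) \<tau>, den (Suc m) \<tau>)" for \<tau>
  have finX: "finite X" by (simp add: X_def finite_permutations)
  have finY: "finite Y" by (simp add: Y_def finite_permutations)
  have card_eq: "card {x \<in> X. f x = k} = card {y \<in> Y. g y = k}" for k
  proof -
    obtain E d where k: "k = (E, d)" by (cases k)
    show ?thesis
    proof (cases "E \<subseteq> {1..m}")
      case True
      define XE where "XE = {(\<sigma>, c). \<sigma> permutes {1..m} \<and> c \<le> m \<and> extended_Exc m \<sigma> c = E}"
      define YE where "YE = {\<tau>. \<tau> permutes {1..Suc m} \<and> Exc (Suc m) \<tau> = E}"
      let ?q = "monom 1 1 :: nat poly"
      have fin: "finite XE" "finite YE"
        by (rule finite_subset[OF _ finX], force simp: XE_def X_def)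
           (rule finite_subset[OF _ finY], force simp: YE_def Y_def)
      have "{x \<in> X. f x = k} = {x \<in> XE. den m (fst x) + snd x = d}"
        by (auto simp: X_def XE_def f_def k)
      also have "card \<dots> = coeff (\<Sum>x\<in>XE. ?q ^ (den m (fst x) + snd x)) d"
        by (rule coeff_sum_power_eq_card[symmetric, OF fin(1)])
      also have "(\<Sum>x\<in>XE. ?q ^ (den m (fst x) + snd x)) = ?q ^ (\<Sum>E) * path_vec ?q E (Suc m) 0"
        using sum_den_extended_Exc[OF True, of ?q] by (simp only: XE_def case_prod_unfold)
      also have "\<dots> = (\<Sum>y\<in>YE. ?q ^ den (Suc m) y)"
        unfolding YE_def by (rule sum_den_fixed_Exc[symmetric]) (use True in auto)
      also have "coeff \<dots> d = card {y \<in> YE. den (Suc m) y = d}"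
        by (rule coeff_sum_power_eq_card[OF fin(2)])
      also have "{y \<in> YE. den (Suc m) y = d} = {y \<in> Y. g y = k}"
        by (auto simp: Y_def YE_def g_def k)
      finally show ?thesis .
    next
      case False
      have "extended_Exc m \<sigma> c \<noteq> E" if "c \<le> m" for \<sigma> c
        using extended_Exc_subset[OF that] False by blast
      then have "{x \<in> X. f x = k} = {}"
        by (auto simp: X_def f_def k)
      \<comment> \<open>The last position cannot be an excedance, so this fibre is empty
        too.\<close>
      moreover have "Exc (Suc m) \<tau> \<noteq> E" if "\<tau> permutes {1..Suc m}" for \<tau>
      proof -
        have "Exc (Suc m) \<tau> \<subseteq> {1..m}"
        proof
          fix i assume i: "i \<in> Exc (Suc m) \<tau>"
          then have "\<tau> i \<in> {1..Suc m}" using permutes_in_image[OF that, of i] by (simp add: Exc_def)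
          then show "i \<in> {1..m}" using i by (simp add: Exc_def)
        qed
        then show ?thesis using False by blast
      qed
      then have "{y \<in> Y. g y = k} = {}"
        by (auto simp: Y_def g_def k)
      ultimately show ?thesis by (simp only: card.empty)
    qed
  qed
  obtain \<phi> where \<phi>: "bij_betw \<phi> X Y" "\<forall>x\<in>X. g (\<phi> x) = f x"
    using bij_betw_of_equal_fibres[OF finX finY card_eq] by blast
  have "Exc (Suc m) (\<phi> (\<sigma>, c)) = extended_Exc m \<sigma> c \<and> den (Suc m) (\<phi> (\<sigma>, c)) = den m \<sigma> + c"
    if "\<sigma> permutes {1..m}" "c \<le> m" for \<sigma> c
    using bspec[OF \<phi>(2), of "(\<sigma>, c)"] that by (simp add: X_def f_def g_def)
  then show ?thesis
    using \<phi>(1) unfolding n X_def Y_def diff_Suc_1 extended_Exc_def by (intro exI[of _ \<phi>]) simp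
qed

end
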